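(* Let $\mu,\mu^\nu\in\mathscr{P}(\Xi)$ ($\nu\in\mathbb{N}$), let $g_0:\mathbb{R}^n\to\overline{\mathbb{R}}$ be proper and lsc, let $h:\mathbb{R}^m\to\overline{\mathbb{R}}$ be proper, lsc and nondecreasing, and let $G,G^\nu:\Xi\times\mathbb{R}^n\to\mathbb{R}^m$ be mappings with random lsc component functions. Assume that the mappings $G(\cdot,x),G^\nu(\cdot,x)$ are uniformly bounded on $\Xi$, locally uniformly in $x$. Let $\alpha\ge 1$. For a fixed $x_0\in\mathbb{R}^n$, suppose that: (i) for every $\nu$, $G^\nu(\xi,x_0)\le G(\xi,x_0)$ for $\mu$-a.e. $\xi$; (ii) $\liminf_{\nu} \mathbb{E}_{\mu^\nu}[G^\nu(\boldsymbol{\xi},x^\nu)]\ge \mathbb{E}_\mu[G(\boldsymbol{\xi},x)]$ (componentwise) for every $x\in\mathbb{R}^n$ and every $x^\nu\to x$; (iii) $\lambda^\nu\in(0,\infty)$, $\lambda^\nu\to0$, and $(\lambda^\nu)^{-1/\alpha}\big(\mathbb{E}_{\mu^\nu}[G^\nu(\boldsymbol{\xi},x_0)]-\mathbb{E}_\mu[G^\nu(\boldsymbol{\xi},x_0)]\big)\to 0$. Define $f,f^\nu:\mathbb{R}^m\times\mathbb{R}^n\to\overline{\mathbb{R}}$ by $$f(u,x)=g_0(x)+h\big(u+\mathbb{E}_\mu[G(\boldsymbol{\xi},x)]\big)+\iota_{\{0\}^m}(u),\qquad f^\nu(u,x)=g_0(x)+h\big(u+\mathbb{E}_{\mu^\nu}[G^\nu(\boldsymbol{\xi},x)]\big)+\tfrac{1}{\alpha\lambda^\nu}\|u\|_2^\alpha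 .$$ Then $f$ and all $f^\nu$ are lsc and: (a) for every $(u,x)\in\mathbb{R}^m\times\mathbb{R}^n$ and every $(u^\nu,x^\nu)\to(u,x)$, $\liminf_\nu f^\nu(u^\nu,x^\nu)\ge f(u,x)$; (b) there exist $u^\nu\to0$ in $\mathbb{R}^m$ such that $\limsup_\nu f^\nu(u^\nu,x_0)\le f(0,x_0)$.
   Context: $\Xi\subseteq\mathbb{R}^d$ is nonempty and closed; $\mathscr{P}(\Xi)$ is the set of Borel probability measures on $\Xi$; $\overline{\mathbb{R}}=[-\infty,\infty]$; lsc = lower semicontinuous. $\iota_C(x)=0$ if $x\in C$ and $\infty$ otherwise. A function is proper if it never takes the value $-\infty$ and is not identically $\infty$. $h$ is nondecreasing if $h(y)\ge h(z)$ whenever $y\ge z$ componentwise. Vector inequalities are componentwise. $\mathbb{E}_\mu[G(\boldsymbol\xi,x)]=\int_\Xi G(\xi,x)\,\mu(d\xi)$. A function $g:\Xi\times\mathbb{R}^n\to\overline{\mathbb{R}}$ is random lsc if the set-valued mapping $\xi\mapsto \operatorname{epi} g(\xi,\cdot)=\{(x,t)\in\mathbb{R}^{n+1}: g(\xi,x)\le t\}$ is closed-valued and measurable (i.e. $\{\xi\in\Xi:\operatorname{epi}g(\xi,\cdot)\cap O\ne\emptyset\}$ is Borel for every open $O\subseteq\mathbb{R}^{n+1}$). A family of mappings $G,G^\nu:\Xi\times\mathbb{R}^n\to\mathbb{R}^m$ is uniformly bounded on $\Xi$, locally uniformly in $x$, if for every $x\in\mathbb{R}^n$ there are $\epsilon_x>0$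 and $M_x<\infty$ such that $\|G(\xi,y)\|_2\le M_x$ and $\|G^\nu(\xi,y)\|_2\le M_x$ for all $\nu$, all $\xi\in\Xi$ and all $y$ with $\|y-x\|_2\le\epsilon_x$. *)

theory Defs
  imports "HOL-Probability.Probability"
begin

text \<open>
  Extended-real functions take values in \<^typ>\<open>ereal\<close>. There \<open>\<infinity> + (-\<infinity>) = \<infinity>\<close>, but this case
  does not arise in sums of proper functions.
\<close>

definition lsc :: "('a::topological_space \<Rightarrow> ereal) \<Rightarrow> bool" where
  "lsc f \<longleftrightarrow> (\<forall>x. f x \<le> Liminf (nhds x) f)"

definition proper_fun :: "('a \<Rightarrow> ereal) \<Rightarrow> bool" where
  "proper_fun f \<longleftrightarrow> (\<forall>x. f x \<noteq> -\<infinity>) \<and> (\<exists>x. f x \<noteq> \<infinity>)"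

definition iota :: "'a set \<Rightarrow> 'a \<Rightarrow> ereal" where
  "iota C x = (if x \<in> C then 0 else \<infinity>)"

abbreviation borel_probs :: "'a::topological_space set \<Rightarrow> 'a measure set" where
  "borel_probs \<Xi> \<equiv> space (prob_algebra (restrict_space borel \<Xi>))"

definition epi :: "('a \<Rightarrow> ereal) \<Rightarrow> ('a \<times> real) set" where
  "epi f = {(x, t). f x \<le> ereal t}"

text \<open>A function on \<open>\<Xi> \<times> \<real>\<^sup>n\<close> is a curried total function of which only the values at \<open>\<xi> \<in> \<Xi>\<close> matter.\<close>

definition random_lsc ::
    "'d::topological_space set \<Rightarrow> ('d \<Rightarrow> 'a::topological_space \<Rightarrow> ereal) \<Rightarrow> bool" where
  "random_lsc \<Xi> g \<longleftrightarrow>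
     (\<forall>\<xi>\<in>\<Xi>. closed (epi (g \<xi>))) \<and>
     (\<forall>S. open S \<longrightarrow> {\<xi>\<in>\<Xi>. epi (g \<xi>) \<inter> S \<noteq> {}} \<in> sets (restrict_space borel \<Xi>))"

definition random_lsc_components ::
    "'d::topological_space set \<Rightarrow> ('d \<Rightarrow> 'a::topological_space \<Rightarrow> real ^ 'm) \<Rightarrow> bool" where
  "random_lsc_components \<Xi> G \<longleftrightarrow> (\<forall>i. random_lsc \<Xi> (\<lambda>\<xi> x. ereal (G \<xi> x $ i)))"

definition loc_unif_bounded ::
    "'d set \<Rightarrow> ('d \<Rightarrow> 'a::metric_space \<Rightarrow> 'b::real_normed_vector) \<Rightarrow> (nat \<Rightarrow> 'd \<Rightarrow> 'a \<Rightarrow> 'b) \<Rightarrow> bool" where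
  "loc_unif_bounded \<Xi> G G\<nu> \<longleftrightarrow>
     (\<forall>x. \<exists>\<epsilon>>0. \<exists>M. \<forall>\<nu>. \<forall>\<xi>\<in>\<Xi>. \<forall>y. dist y x \<le> \<epsilon> \<longrightarrow>
        norm (G \<xi> y) \<le> M \<and> norm (G\<nu> \<nu> \<xi> y) \<le> M)"

end

theory Submission
  imports Defs
begin

text \<open>
  A nondecreasing lower semicontinuous \<open>h\<close> preserves componentwise lower limits, so (a) follows
  from (ii) termwise, and the lower semicontinuity claims follow from Fatou's lemma. For (b), the
  perturbation \<open>u\<^sup>\<nu> = E\<^sub>\<mu>[G\<^sup>\<nu>(\<xi>, x\<^sub>0)] - E\<^bsub>\<mu>\<^sup>\<nu>\<^esub>[G\<^sup>\<nu>(\<xi>, x\<^sub>0)]\<close> replaces \<open>\<mu>\<^sup>\<nu>\<close> by \<open>\<mu>\<close> inside \<open>h\<close>, after which (i)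
  and monotonicity apply, while (iii) makes the penalty vanish.
\<close>

section \<open>Sequential lower semicontinuity and componentwise lower limits\<close>

text \<open>In a first countable space a neighbourhood property can be tested along convergent
  sequences. The lower semicontinuity of \<open>f\<close> and \<open>f\<nu> \<nu>\<close> is proved
  in this form.\<close>

lemma lsc_iff_sequentially:
  fixes f :: "'a::first_countable_topology \<Rightarrow> ereal"
  shows "lsc f \<longleftrightarrow> (\<forall>x X. X \<longlonglongrightarrow> x \<longrightarrow> f x \<le> liminf (\<lambda>n. f (X n)))"
proof
  assume L: "lsc f"
  show "\<forall>x X. X \<longlonglongrightarrow> x \<longrightarrow> f x \<le> liminf (\<lambda>n. f (X n))"
  proof (intro allI impI)
    fix x :: 'a and X :: "nat \<Rightarrow> 'a"
    assume X: "X \<longlonglongrightarrow> x"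
    have "f x \<le> Liminf (nhds x) f"
      using L by (simp add: lsc_def)
    then have "\<forall>y<f x. eventually (\<lambda>z. y < f z) (nhds x)"
      by (simp add: le_Liminf_iff)
    then have "\<forall>y<f x. eventually (\<lambda>n. y < f (X n)) sequentially"
      using X eventually_compose_filterlim by blast
    then show "f x \<le> liminf (\<lambda>n. f (X n))"
      by (simp add: le_Liminf_iff)
  qed
next
  assume R: "\<forall>x X. X \<longlonglongrightarrow> x \<longrightarrow> f x \<le> liminf (\<lambda>n. f (X n))"
  show "lsc f"
    unfolding lsc_def le_Liminf_iff
  proof (intro allI impI)
    fix x y assume y: "y < f x"
    \<comment> \<open>Intersecting with \<open>principal UNIV\<close> changes nothing; it brings the
      filter into the shape that the sequence criterion expects.\<close>
    have "eventually (\<lambda>z. y < f z) (inf (nhds x) (principal UNIV))"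
    proof (rule sequentially_imp_eventually_nhds_within, intro allI impI)
      fix X :: "nat \<Rightarrow> 'a" assume "(\<forall>n. X n \<in> UNIV) \<and> X \<longlonglongrightarrow> x"
      then have "f x \<le> liminf (\<lambda>n. f (X n))" using R by blast
      then show "eventually (\<lambda>n. y < f (X n)) sequentially"
        using y by (simp add: le_Liminf_iff)
    qed
    then show "eventually (\<lambda>z. y < f z) (nhds x)" by simp
  qed
qed

lemma lsc_sequentiallyD:
  fixes f :: "'a::first_countable_topology \<Rightarrow> ereal"
  shows "lsc f \<Longrightarrow> X \<longlonglongrightarrow> x \<Longrightarrow> f x \<le> liminf (\<lambda>n. f (X n))"
  by (simp add: lsc_iff_sequentially)

text \<open>Since \<infinity> + (-\<infinity>) = \<infinity>, lower limits are not superadditive in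
  general. Lower bounds other than -\<infinity> keep both lower limits away from -\<infinity> and so
  exclude the bad case.\<close>

lemma liminf_add_ge:
  fixes u v :: "nat \<Rightarrow> ereal"
  assumes "a \<le> liminf u" "b \<le> liminf v" "a \<noteq> -\<infinity>" "b \<noteq> -\<infinity>"
  shows "a + b \<le> liminf (\<lambda>n. u n + v n)"
proof -
  have "a + b \<le> liminf u + liminf v"
    using assms by (intro add_mono)
  also have "\<dots> \<le> liminf (\<lambda>n. u n + v n)"
    using assms by (intro ereal_liminf_add_mono) auto
  finally show ?thesis .
qed

text \<open>\<open>V\<close> need not converge, so \<open>v\<close> is lowered by
  \<open>1 / (k + 1)\<close> in every coordinate. The resulting \<open>w k\<close> is eventually
  below \<open>V n\<close> in all of the finitely many coordinates, and monotonicity bounds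
  \<open>h (w k)\<close> by the lower limit. As \<open>w\<close> tends to \<open>v\<close>, lower
  semicontinuity recovers \<open>h v\<close>.\<close>

lemma liminf_mono_lsc_ge:
  fixes h :: "real ^ 'm \<Rightarrow> ereal"
  assumes "lsc h" "mono h"
    and V: "\<And>j. ereal (v $ j) \<le> liminf (\<lambda>n. ereal (V n $ j))"
  shows "h v \<le> liminf (\<lambda>n. h (V n))"
proof -
  define w :: "nat \<Rightarrow> real ^ 'm" where "w k = (\<chi> j. v $ j - inverse (real (Suc k)))" for k
  have "w \<longlonglongrightarrow> v"
  proof (rule vec_tendstoI)
    fix j
    have "(\<lambda>k. v $ j - inverse (real (Suc k))) \<longlonglongrightarrow> v $ j - 0"
      by (intro tendsto_intros LIMSEQ_inverse_real_of_nat)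
    then show "(\<lambda>k. w k $ j) \<longlonglongrightarrow> v $ j" by (simp add: w_def)
  qed
  then have "h v \<le> liminf (\<lambda>k. h (w k))"
    by (rule lsc_sequentiallyD[OF \<open>lsc h\<close>])
  moreover have "h (w k) \<le> liminf (\<lambda>n. h (V n))" for k
  proof (rule Liminf_bounded)
    have "eventually (\<lambda>n. w k $ j < V n $ j) sequentially" for j
    proof -
      have "ereal (w k $ j) < ereal (v $ j)" by (simp add: w_def)
      then have "eventually (\<lambda>n. ereal (w k $ j) < ereal (V n $ j)) sequentially"
        using V[of j] unfolding le_Liminf_iff by blast
      then show ?thesis by simp
    qed
    then have "eventually (\<lambda>n. \<forall>j. w k $ j < V n $ j) sequentially"
      by (simp add: eventually_all_finite)
    then show "eventually (\<lambda>n. h (w k) \<le> h (V n)) sequentially"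
      by eventually_elim (intro monoD[OF \<open>mono h\<close>], simp add: less_eq_vec_def less_imp_le)
  qed
  then have "liminf (\<lambda>k. h (w k)) \<le> liminf (\<lambda>n. h (V n))"
    by (intro Liminf_le) auto
  ultimately show ?thesis by (rule order_trans)
qed

lemma liminf_add_tendsto_ge:
  assumes U: "U \<longlonglongrightarrow> u" and E: "ereal a \<le> liminf (\<lambda>n. ereal (E n))"
  shows "ereal ((u::real) + a) \<le> liminf (\<lambda>n. ereal (U n + E n))"
proof -
  have "liminf (\<lambda>n. ereal (U n)) = ereal u"
    using U by (intro lim_imp_Liminf) auto
  then have "ereal u + ereal a \<le> liminf (\<lambda>n. ereal (U n) + ereal (E n))"
    using E by (intro liminf_add_ge) auto
  then show ?thesis by simp
qed

section \<open>Random lsc functions: measurability, integrability and Fatou's lemma\<close>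

text \<open>The point \<open>(x, y)\<close> lies in the open complement of the epigraph, hence so
  does \<open>(X n, y)\<close> for all large \<open>n\<close>. This turns closed-valuedness into the
  pointwise lower limit required by Fatou's lemma.\<close>

lemma closed_epi_sequentially:
  assumes cl: "closed (epi (\<lambda>x. ereal (g x)))" and X: "X \<longlonglongrightarrow> (x::'a::first_countable_topology)"
    and "y < g x"
  shows "eventually (\<lambda>n. y < g (X n)) sequentially"
proof -
  have "open (- epi (\<lambda>x. ereal (g x)))" "(x, y) \<in> - epi (\<lambda>x. ereal (g x))"
    using assms by (auto simp: epi_def)
  moreover have "(\<lambda>n. (X n, y)) \<longlonglongrightarrow> (x, y)"
    using X by (intro tendsto_intros)
  ultimately have "eventually (\<lambda>n. (X n, y) \<in> - epi (\<lambda>x. ereal (g x))) sequentially"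
    by (rule topological_tendstoD[rotated 1])
  then show ?thesis by (simp add: epi_def not_le)
qed

text \<open>
  As the epigraph is closed, \<open>g \<xi> x \<le> t\<close> means that it meets every ball around \<open>(x, t)\<close>.
\<close>

lemma random_lsc_measurable:
  fixes g :: "'d::topological_space \<Rightarrow> 'a::metric_space \<Rightarrow> real"
  assumes g: "random_lsc \<Xi> (\<lambda>\<xi> x. ereal (g \<xi> x))"
    and sets: "sets \<mu> = sets (restrict_space borel \<Xi>)"
  shows "(\<lambda>\<xi>. g \<xi> x) \<in> borel_measurable \<mu>"
proof -
  let ?e = "\<lambda>\<xi>. epi (\<lambda>x. ereal (g \<xi> x))"
  have sp: "space \<mu> = \<Xi>"
    using sets_eq_imp_space_eq[OF sets] by (simp add: space_restrict_space)
  have "{\<xi> \<in> space \<mu>. g \<xi> x \<le> t} \<in> sets \<mu>" for t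
  proof -
    have "g \<xi> x \<le> t \<longleftrightarrow> (\<forall>k::nat. ?e \<xi> \<inter> ball (x, t) (inverse (real (Suc k))) \<noteq> {})"
      if "\<xi> \<in> \<Xi>" for \<xi>
    proof -
      have cl: "closed (?e \<xi>)" using g that by (auto simp: random_lsc_def)
      have "g \<xi> x \<le> t \<longleftrightarrow> (x, t) \<in> ?e \<xi>" by (simp add: epi_def)
      also have "\<dots> \<longleftrightarrow> (x, t) \<in> closure (?e \<xi>)" using cl by simp
      also have "\<dots> \<longleftrightarrow> (\<forall>k::nat. ?e \<xi> \<inter> ball (x, t) (inverse (real (Suc k))) \<noteq> {})"
      proof
        assume "(x, t) \<in> closure (?e \<xi>)"
        then show "\<forall>k::nat. ?e \<xi> \<inter> ball (x, t) (inverse (real (Suc k))) \<noteq> {}"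
          unfolding closure_approachable
          by (metis IntI dist_commute empty_iff mem_ball inverse_positive_iff_positive of_nat_0_less_iff zero_less_Suc)
      next
        assume A: "\<forall>k::nat. ?e \<xi> \<inter> ball (x, t) (inverse (real (Suc k))) \<noteq> {}"
        show "(x, t) \<in> closure (?e \<xi>)"
          unfolding closure_approachable
        proof (intro allI impI)
          fix e :: real assume "e > 0"
          then obtain k where "inverse (real (Suc k)) < e" using reals_Archimedean by blast
          moreover obtain y where "y \<in> ?e \<xi>" "dist (x, t) y < inverse (real (Suc k))"
            using A by (metis Int_emptyI mem_ball)
          ultimately show "\<exists>y\<in>?e \<xi>. dist y (x, t) < e"
            by (metis dist_commute less_trans)
        qed
      qed
      finally show ?thesis .
    qed
    then have "{\<xi> \<in> space \<mu>. g \<xi> x \<le> t} =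
        (\<Inter>k::nat. {\<xi> \<in> \<Xi>. ?e \<xi> \<inter> ball (x, t) (inverse (real (Suc k))) \<noteq> {}})"
      using sp by auto
    \<comment> \<open>The intersection is countable, and each of its sets is measurable by
      \<open>random_lsc\<close> because balls are open.\<close>
    also have "\<dots> \<in> sets \<mu>"
      using g sets by (intro sets.countable_INT) (auto simp: random_lsc_def)
    finally show ?thesis .
  qed
  then show ?thesis by (rule borel_measurableI_le)
qed

lemma borel_probsD:
  assumes "\<mu> \<in> borel_probs \<Xi>"
  shows "prob_space \<mu>" "sets \<mu> = sets (restrict_space borel \<Xi>)" "space \<mu> = \<Xi>"
proof -
  show "prob_space \<mu>" and s: "sets \<mu> = sets (restrict_space borel \<Xi>)"
    using assms by (auto simp: space_prob_algebra)
  show "space \<mu> = \<Xi>"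
    using sets_eq_imp_space_eq[OF s] by (simp add: space_restrict_space)
qed

text \<open>Measurability reduces to the components, and a bounded measurable map is integrable for
  a probability measure. This makes the integrals genuine expectations rather than the default value
  0 of a non-integrable map.\<close>

lemma integrable_random_lsc_components:
  fixes F :: "'d::topological_space \<Rightarrow> 'a::metric_space \<Rightarrow> real ^ 'm"
  assumes \<mu>: "\<mu> \<in> borel_probs \<Xi>" and F: "random_lsc_components \<Xi> F"
    and bd: "\<And>\<xi>. \<xi> \<in> \<Xi> \<Longrightarrow> norm (F \<xi> x) \<le> M"
  shows "integrable \<mu> (\<lambda>\<xi>. F \<xi> x)"
proof -
  interpret prob_space \<mu> using borel_probsD[OF \<mu>] by simp
  have "(\<lambda>\<xi>. F \<xi> x $ j) \<in> borel_measurable \<mu>" for j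
    using F borel_probsD[OF \<mu>] by (intro random_lsc_measurable) (auto simp: random_lsc_components_def)
  then have "(\<lambda>\<xi>. F \<xi> x) \<in> borel_measurable \<mu>"
    by (subst borel_measurable_euclidean_space) (auto simp: Basis_vec_def inner_axis)
  then show ?thesis
    using bd borel_probsD[OF \<mu>] by (intro integrable_const_bound[where B = M]) auto
qed

lemma integral_vec_nth:
  "integrable M F \<Longrightarrow> (LINT \<xi>|M. F \<xi>) $ j = (LINT \<xi>|M. F \<xi> $ j)" for F :: "'d \<Rightarrow> real ^ 'm"
  using integral_bounded_linear[OF bounded_linear_vec_nth] by metis

text \<open>Fatou's lemma needs nonnegative integrands. A bound \<open>M\<close> valid near
  \<open>x\<close> makes \<open>F \<xi> y $ j + M\<close> nonnegative for \<open>y\<close> near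
  \<open>x\<close>, and \<open>X n\<close> is eventually that near; the shift is undone at the
  end.\<close>

lemma liminf_integral_random_lsc_ge:
  fixes F :: "'d::topological_space \<Rightarrow> 'a::metric_space \<Rightarrow> real ^ 'm"
  assumes \<mu>: "\<mu> \<in> borel_probs \<Xi>" and F: "random_lsc_components \<Xi> F"
    and bd: "\<And>x. \<exists>\<epsilon>>0. \<exists>M. \<forall>\<xi>\<in>\<Xi>. \<forall>y. dist y x \<le> \<epsilon> \<longrightarrow> norm (F \<xi> y) \<le> M"
    and X: "X \<longlonglongrightarrow> x"
  shows "ereal ((LINT \<xi>|\<mu>. F \<xi> x) $ j) \<le> liminf (\<lambda>n. ereal ((LINT \<xi>|\<mu>. F \<xi> (X n)) $ j))"
proof -
  interpret prob_space \<mu> using borel_probsD[OF \<mu>] by simp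
  note sp = borel_probsD(3)[OF \<mu>]
  obtain \<epsilon> M where "\<epsilon> > 0" and M: "\<And>\<xi> y. \<xi> \<in> \<Xi> \<Longrightarrow> dist y x \<le> \<epsilon> \<Longrightarrow> norm (F \<xi> y) \<le> M"
    using bd[of x] by blast
  have int: "integrable \<mu> (\<lambda>\<xi>. F \<xi> y)" for y
  proof -
    obtain \<epsilon> M where "\<epsilon> > 0" "\<And>\<xi> z. \<xi> \<in> \<Xi> \<Longrightarrow> dist z y \<le> \<epsilon> \<Longrightarrow> norm (F \<xi> z) \<le> M"
      using bd[of y] by blast
    then show ?thesis
      by (intro integrable_random_lsc_components[OF \<mu> F, of _ M]) auto
  qed
  have intj: "integrable \<mu> (\<lambda>\<xi>. F \<xi> y $ j)" for y
    using integrable_bounded_linear[OF bounded_linear_vec_nth int] .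
  \<comment> \<open>The total mass is 1, so integrating the shift contributes exactly
    \<open>M\<close>. The sign is recorded because \<open>ennreal\<close> truncates negative numbers
    to 0.\<close>
  have nn: "(\<integral>\<^sup>+\<xi>. ennreal (F \<xi> y $ j + M) \<partial>\<mu>) = ennreal ((LINT \<xi>|\<mu>. F \<xi> y $ j) + M)
      \<and> 0 \<le> (LINT \<xi>|\<mu>. F \<xi> y $ j) + M"
    if "dist y x \<le> \<epsilon>" for y
  proof -
    have pos: "0 \<le> F \<xi> y $ j + M" if "\<xi> \<in> \<Xi>" for \<xi>
      using M[OF that \<open>dist y x \<le> \<epsilon>\<close>] component_le_norm_cart[of "F \<xi> y" j] by linarith
    have "(\<integral>\<^sup>+\<xi>. ennreal (F \<xi> y $ j + M) \<partial>\<mu>) = ennreal (LINT \<xi>|\<mu>. F \<xi> y $ j + M)"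
      using pos sp intj by (intro nn_integral_eq_integral) auto
    moreover have "(LINT \<xi>|\<mu>. F \<xi> y $ j + M) = (LINT \<xi>|\<mu>. F \<xi> y $ j) + M"
      using intj by (simp add: prob_space)
    moreover have "0 \<le> (LINT \<xi>|\<mu>. F \<xi> y $ j + M)"
      using pos sp by (intro integral_nonneg_AE) auto
    ultimately show ?thesis by simp
  qed
  have ev: "eventually (\<lambda>n. dist (X n) x \<le> \<epsilon>) sequentially"
    using tendstoD[OF X \<open>\<epsilon> > 0\<close>] by eventually_elim simp
  \<comment> \<open>Early terms \<open>X n\<close> may lie outside the ball, where the integrand may
    be truncated to 0; this does not affect the lower limit.\<close>
  have fatou: "(\<integral>\<^sup>+\<xi>. ennreal (F \<xi> x $ j + M) \<partial>\<mu>)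
      \<le> liminf (\<lambda>n. \<integral>\<^sup>+\<xi>. ennreal (F \<xi> (X n) $ j + M) \<partial>\<mu>)"
  proof -
    have "(\<integral>\<^sup>+\<xi>. ennreal (F \<xi> x $ j + M) \<partial>\<mu>)
        \<le> (\<integral>\<^sup>+\<xi>. liminf (\<lambda>n. ennreal (F \<xi> (X n) $ j + M)) \<partial>\<mu>)"
    proof (rule nn_integral_mono)
      fix \<xi> assume "\<xi> \<in> space \<mu>"
      then have cl: "closed (epi (\<lambda>x. ereal (F \<xi> x $ j)))"
        using F sp by (auto simp: random_lsc_components_def random_lsc_def)
      show "ennreal (F \<xi> x $ j + M) \<le> liminf (\<lambda>n. ennreal (F \<xi> (X n) $ j + M))"
        unfolding le_Liminf_iff
      proof (intro allI impI)
        fix c assume c: "c < ennreal (F \<xi> x $ j + M)"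
        then obtain r where r: "c = ennreal r" "0 \<le> r"
          by (cases c) auto
        then have "r - M < F \<xi> x $ j"
          using c by (simp add: ennreal_less_iff)
        then have "eventually (\<lambda>n. r - M < F \<xi> (X n) $ j) sequentially"
          by (rule closed_epi_sequentially[OF cl X])
        then show "eventually (\<lambda>n. c < ennreal (F \<xi> (X n) $ j + M)) sequentially"
          by eventually_elim (use r in \<open>simp add: ennreal_less_iff\<close>)
      qed
    qed
    also have "\<dots> \<le> liminf (\<lambda>n. \<integral>\<^sup>+\<xi>. ennreal (F \<xi> (X n) $ j + M) \<partial>\<mu>)"
      using borel_measurable_integrable[OF intj] by (intro nn_integral_liminf) auto
    finally show ?thesis .
  qed
  show ?thesis
    unfolding le_Liminf_iff
  proof (intro allI impI)
    fix c assume c: "c < ereal ((LINT \<xi>|\<mu>. F \<xi> x) $ j)"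
    \<comment> \<open>A level \<open>c\<close> below \<open>-M\<close> is eventually exceeded since
      the expectations are at least \<open>-M\<close>. Any other level is a real \<open>r\<close>
      with \<open>r + M\<close> nonnegative, so the comparison transfers to \<open>ennreal\<close>
      without truncation.\<close>
    show "eventually (\<lambda>n. c < ereal ((LINT \<xi>|\<mu>. F \<xi> (X n)) $ j)) sequentially"
    proof (cases "c < ereal (-M)")
      case True
      show ?thesis
        using ev
      proof eventually_elim
        case (elim n)
        have "ereal (- M) \<le> ereal (LINT \<xi>|\<mu>. F \<xi> (X n) $ j)" using nn[OF elim] by simp
        then show ?case using less_le_trans[OF True] int by (simp add: integral_vec_nth)
      qed
    next
      case False
      then obtain r where r: "c = ereal r" "- M \<le> r"
        using c by (cases c) auto
      have "ennreal (r + M) < (\<integral>\<^sup>+\<xi>. ennreal (F \<xi> x $ j + M) \<partial>\<mu>)"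
        using c r nn[of x] \<open>\<epsilon> > 0\<close> int by (simp add: ennreal_less_iff integral_vec_nth)
      then have "eventually (\<lambda>n. ennreal (r + M) < (\<integral>\<^sup>+\<xi>. ennreal (F \<xi> (X n) $ j + M) \<partial>\<mu>)) sequentially"
        using fatou by (simp only: le_Liminf_iff)
      with ev show ?thesis
      proof eventually_elim
        case (elim n)
        then show ?case using nn[OF elim(1)] r int by (simp add: ennreal_less_iff integral_vec_nth)
      qed
    qed
  qed
qed

section \<open>The penalty term\<close>

text \<open>For \<open>u \<noteq> 0\<close> the coefficient tends to \<infinity> while the power of
  the norm has a positive limit; for \<open>u = 0\<close> nonnegativity of the penalty suffices. The
  vanishing parameter thus enforces the constraint \<open>u = 0\<close> in the limit.\<close>

lemma liminf_penalty_ge_iota: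
  fixes U :: "nat \<Rightarrow> 'a::real_normed_vector"
  assumes "\<alpha> > 0" and lam: "\<And>\<nu>. lam \<nu> > 0" "lam \<longlonglongrightarrow> 0" and U: "U \<longlonglongrightarrow> u"
  shows "iota {0} u \<le> liminf (\<lambda>\<nu>. ereal (1 / (\<alpha> * lam \<nu>) * norm (U \<nu>) powr \<alpha>))"
proof (cases "u = 0")
  case True
  then show ?thesis
    using lam(1) \<open>\<alpha> > 0\<close>
    by (intro Liminf_bounded always_eventually allI) (simp add: iota_def less_imp_le)
next
  case False
  have "filterlim (\<lambda>\<nu>. inverse (\<alpha> * lam \<nu>)) at_top sequentially"
  proof (rule filterlim_inverse_at_top)
    show "(\<lambda>\<nu>. \<alpha> * lam \<nu>) \<longlonglongrightarrow> 0" using tendsto_mult_right_zero[OF lam(2)] .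
  qed (use lam(1) \<open>\<alpha> > 0\<close> in auto)
  moreover have "(\<lambda>\<nu>. norm (U \<nu>) powr \<alpha>) \<longlonglongrightarrow> norm u powr \<alpha>"
    using U False by (intro tendsto_intros) auto
  ultimately have "filterlim (\<lambda>\<nu>. norm (U \<nu>) powr \<alpha> * inverse (\<alpha> * lam \<nu>)) at_top sequentially"
    using False by (intro filterlim_tendsto_pos_mult_at_top) auto
  then have "(\<lambda>\<nu>. ereal (1 / (\<alpha> * lam \<nu>) * norm (U \<nu>) powr \<alpha>)) \<longlonglongrightarrow> \<infinity>"
    by (intro tendsto_PInfty_eq_at_top[THEN iffD2]) (simp add: field_simps)
  then show ?thesis
    using lim_imp_Liminf[of sequentially] by force
qed

text \<open>Raising the factor \<open>l powr (- 1 / \<alpha>)\<close> to the power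
  \<open>\<alpha>\<close> gives \<open>1 / l\<close>. The penalty is thereby expressed through the
  rescaled vector whose convergence is assumed in (iii).\<close>

lemma penalty_eq:
  assumes "\<alpha> > 0" "l > 0"
  shows "1 / (\<alpha> * l) * norm u powr \<alpha> = 1 / \<alpha> * norm (l powr (- 1 / \<alpha>) *\<^sub>R u) powr \<alpha>"
proof -
  have "norm (l powr (- 1 / \<alpha>) *\<^sub>R u) powr \<alpha> = (l powr (- 1 / \<alpha>)) powr \<alpha> * norm u powr \<alpha>"
    by (simp add: powr_mult)
  also have "(l powr (- 1 / \<alpha>)) powr \<alpha> = 1 / l"
    unfolding powr_powr using assms by (simp add: powr_minus_divide)
  finally show ?thesis by simp
qed

theorem theorem2p2:
  fixes \<Xi> :: "(real ^ 'd) set"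
    and \<mu> :: "(real ^ 'd) measure" and \<mu>\<nu> :: "nat \<Rightarrow> (real ^ 'd) measure"
    and g0 :: "real ^ 'n \<Rightarrow> ereal" and h :: "real ^ 'm \<Rightarrow> ereal"
    and G :: "real ^ 'd \<Rightarrow> real ^ 'n \<Rightarrow> real ^ 'm"
    and G\<nu> :: "nat \<Rightarrow> real ^ 'd \<Rightarrow> real ^ 'n \<Rightarrow> real ^ 'm"
    and \<alpha> :: real and lam :: "nat \<Rightarrow> real" and x0 :: "real ^ 'n"
    and f :: "(real ^ 'm) \<times> (real ^ 'n) \<Rightarrow> ereal"
    and f\<nu> :: "nat \<Rightarrow> (real ^ 'm) \<times> (real ^ 'n) \<Rightarrow> ereal"
  assumes "\<Xi> \<noteq> {}" and "closed \<Xi>"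
    and "\<mu> \<in> borel_probs \<Xi>" and "\<And>\<nu>. \<mu>\<nu> \<nu> \<in> borel_probs \<Xi>"
    and "proper_fun g0" and "lsc g0"
    and "proper_fun h" and "lsc h" and "mono h"
    and "random_lsc_components \<Xi> G" and "\<And>\<nu>. random_lsc_components \<Xi> (G\<nu> \<nu>)"
    and "loc_unif_bounded \<Xi> G G\<nu>"
    and "\<alpha> \<ge> 1"
    and i: "\<And>\<nu>. AE \<xi> in \<mu>. G\<nu> \<nu> \<xi> x0 \<le> G \<xi> x0"
    and ii: "\<And>x X j. X \<longlonglongrightarrow> x \<Longrightarrow>
          liminf (\<lambda>\<nu>. ereal ((LINT \<xi>|\<mu>\<nu> \<nu>. G\<nu> \<nu> \<xi> (X \<nu>)) $ j)) \<ge> ereal ((LINT \<xi>|\<mu>. G \<xi> x) $ j)"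
    and iii: "\<And>\<nu>. lam \<nu> > 0" "lam \<longlonglongrightarrow> 0"
          "(\<lambda>\<nu>. (lam \<nu> powr (- 1 / \<alpha>)) *\<^sub>R
             ((LINT \<xi>|\<mu>\<nu> \<nu>. G\<nu> \<nu> \<xi> x0) - (LINT \<xi>|\<mu>. G\<nu> \<nu> \<xi> x0))) \<longlonglongrightarrow> 0"
    and f: "\<And>u x. f (u, x) = g0 x + h (u + (LINT \<xi>|\<mu>. G \<xi> x)) + iota {0} u"
    and f\<nu>: "\<And>\<nu> u x. f\<nu> \<nu> (u, x) =
          g0 x + h (u + (LINT \<xi>|\<mu>\<nu> \<nu>. G\<nu> \<nu> \<xi> x)) + ereal (1 / (\<alpha> * lam \<nu>) * norm u powr \<alpha>)"
  shows "lsc f \<and> (\<forall>\<nu>. lsc (f\<nu> \<nu>)) \<and>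
    (\<forall>u x U X. U \<longlonglongrightarrow> u \<longrightarrow> X \<longlonglongrightarrow> x \<longrightarrow> liminf (\<lambda>\<nu>. f\<nu> \<nu> (U \<nu>, X \<nu>)) \<ge> f (u, x)) \<and>
    (\<exists>U. U \<longlonglongrightarrow> 0 \<and> limsup (\<lambda>\<nu>. f\<nu> \<nu> (U \<nu>, x0)) \<le> f (0, x0))"
proof (intro conjI allI impI)
  have "\<alpha> > 0" using \<open>\<alpha> \<ge> 1\<close> by simp
  have g0_ninf: "g0 x \<noteq> -\<infinity>" and h_ninf: "h v \<noteq> -\<infinity>" for x v
    using \<open>proper_fun g0\<close> \<open>proper_fun h\<close> by (auto simp: proper_fun_def)
  \<comment> \<open>This fits the three summands of \<open>f\<close> and \<open>f\<nu>\<close>,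
    whose lower bounds are never -\<infinity>.\<close>
  have sum_ge: "(a + b) + c \<le> liminf (\<lambda>n. (A n + B n) + C n)"
    if "a \<le> liminf A" "b \<le> liminf B" "c \<le> liminf C" "a \<noteq> -\<infinity>" "b \<noteq> -\<infinity>" "c \<noteq> -\<infinity>"
    for a b c :: ereal and A B C :: "nat \<Rightarrow> ereal"
    using that by (intro liminf_add_ge) auto
  \<comment> \<open>Of the two parts of the argument of \<open>h\<close>, the perturbation
    converges, while for the expectation only a componentwise lower limit is available.\<close>
  have h_ge: "h (u + e) \<le> liminf (\<lambda>n. h (U n + E n))"
    if "U \<longlonglongrightarrow> u" "\<And>j. ereal (e $ j) \<le> liminf (\<lambda>n. ereal (E n $ j))" for u e U E
  proof (rule liminf_mono_lsc_ge[OF \<open>lsc h\<close> \<open>mono h\<close>])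
    show "ereal ((u + e) $ j) \<le> liminf (\<lambda>n. ereal ((U n + E n) $ j))" for j
      using liminf_add_tendsto_ge[OF tendsto_vec_nth[OF that(1)] that(2)] by simp
  qed
  have bd: "\<exists>\<epsilon>>0. \<exists>M. \<forall>\<xi>\<in>\<Xi>. \<forall>y. dist y x \<le> \<epsilon> \<longrightarrow> norm (G \<xi> y) \<le> M"
    and bd\<nu>: "\<exists>\<epsilon>>0. \<exists>M. \<forall>\<xi>\<in>\<Xi>. \<forall>y. dist y x \<le> \<epsilon> \<longrightarrow> norm (G\<nu> \<nu> \<xi> y) \<le> M" for x \<nu>
    using \<open>loc_unif_bounded \<Xi> G G\<nu>\<close> unfolding loc_unif_bounded_def by meson+

  \<comment> \<open>Lower semicontinuity of \<open>f\<close> and of every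
    \<open>f\<nu> \<nu>\<close>\<close>
  show "lsc f"
    unfolding lsc_iff_sequentially
  proof (intro allI impI)
    fix p and P :: "nat \<Rightarrow> (real ^ 'm) \<times> (real ^ 'n)"
    assume P: "P \<longlonglongrightarrow> p"
    obtain u x where p: "p = (u, x)" by (cases p)
    define U X where "U n = fst (P n)" and "X n = snd (P n)" for n
    have UX: "U \<longlonglongrightarrow> u" "X \<longlonglongrightarrow> x"
      using tendsto_fst[OF P] tendsto_snd[OF P] by (simp_all add: p U_def[abs_def] X_def[abs_def])
    have "f (P n) = g0 (X n) + h (U n + (LINT \<xi>|\<mu>. G \<xi> (X n))) + iota {0} (U n)" for n
      using f[of "U n" "X n"] by (simp add: U_def X_def)
    \<comment> \<open>The set \<open>{0}\<close> is closed: if \<open>u\<close> is nonzero, then so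
      is \<open>U n\<close> eventually, and both sides are \<infinity>.\<close>
    moreover have "iota {0} u \<le> liminf (\<lambda>n. iota {0} (U n))"
    proof (cases "u = 0")
      case False
      then have "eventually (\<lambda>n. U n \<noteq> 0) sequentially"
        using UX tendsto_imp_eventually_ne by blast
      then show ?thesis
        by (intro Liminf_bounded) (auto elim!: eventually_mono simp: iota_def)
    qed (auto simp: iota_def intro!: Liminf_bounded always_eventually)
    ultimately show "f p \<le> liminf (\<lambda>n. f (P n))"
      using UX unfolding p f
      by (simp only:) (intro sum_ge h_ge lsc_sequentiallyD[OF \<open>lsc g0\<close>] g0_ninf h_ninf
          liminf_integral_random_lsc_ge[OF \<open>\<mu> \<in> borel_probs \<Xi>\<close> \<open>random_lsc_components \<Xi> G\<close> bd];
          simp add: iota_def)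
  qed

  show "lsc (f\<nu> \<nu>)" for \<nu>
    unfolding lsc_iff_sequentially
  proof (intro allI impI)
    fix p and P :: "nat \<Rightarrow> (real ^ 'm) \<times> (real ^ 'n)"
    assume P: "P \<longlonglongrightarrow> p"
    obtain u x where p: "p = (u, x)" by (cases p)
    define U X where "U n = fst (P n)" and "X n = snd (P n)" for n
    have UX: "U \<longlonglongrightarrow> u" "X \<longlonglongrightarrow> x"
      using tendsto_fst[OF P] tendsto_snd[OF P] by (simp_all add: p U_def[abs_def] X_def[abs_def])
    let ?p = "\<lambda>u. ereal (1 / (\<alpha> * lam \<nu>) * norm u powr \<alpha>)"
    have "f\<nu> \<nu> (P n) = g0 (X n) + h (U n + (LINT \<xi>|\<mu>\<nu> \<nu>. G\<nu> \<nu> \<xi> (X n))) + ?p (U n)" for n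
      using f\<nu>[of \<nu> "U n" "X n"] by (simp add: U_def X_def)
    moreover have "?p u \<le> liminf (\<lambda>n. ?p (U n))"
    proof -
      \<comment> \<open>The limit of the norms may be 0, where continuity of \<open>powr\<close>
        rests on \<open>\<alpha> > 0\<close>.\<close>
      have "(\<lambda>n. norm (U n) powr \<alpha>) \<longlonglongrightarrow> norm u powr \<alpha>"
        using UX \<open>\<alpha> > 0\<close> by (intro tendsto_powr2 tendsto_norm tendsto_const) auto
      then have "(\<lambda>n. ?p (U n)) \<longlonglongrightarrow> ?p u"
        by (intro tendsto_ereal tendsto_mult tendsto_const)
      then show ?thesis
        by (rule lim_imp_Liminf[OF sequentially_bot, THEN eq_refl[OF sym]])
    qed
    ultimately show "f\<nu> \<nu> p \<le> liminf (\<lambda>n. f\<nu> \<nu> (P n))"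
      using UX unfolding p f\<nu>
      by (simp only:) (intro sum_ge h_ge lsc_sequentiallyD[OF \<open>lsc g0\<close>] g0_ninf h_ninf
          liminf_integral_random_lsc_ge[OF \<open>\<mu>\<nu> \<nu> \<in> borel_probs \<Xi>\<close> \<open>random_lsc_components \<Xi> (G\<nu> \<nu>)\<close> bd\<nu>];
          simp)
  qed

  \<comment> \<open>The lower limit inequality (a)\<close>
  show "f (u, x) \<le> liminf (\<lambda>\<nu>. f\<nu> \<nu> (U \<nu>, X \<nu>))" if UX: "U \<longlonglongrightarrow> u" "X \<longlonglongrightarrow> x" for u x U X
    \<comment> \<open>Measures and integrands now vary with \<nu>, so (ii) takes the place of
      Fatou's lemma for the expectation.\<close>
    unfolding f f\<nu>
    by (intro sum_ge h_ge lsc_sequentiallyD[OF \<open>lsc g0\<close>] g0_ninf h_ninf UX ii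
        liminf_penalty_ge_iota \<open>\<alpha> > 0\<close> iii) (simp add: iota_def)

  \<comment> \<open>The recovery sequence for (b)\<close>
  define w where "w \<nu> = (LINT \<xi>|\<mu>\<nu> \<nu>. G\<nu> \<nu> \<xi> x0) - (LINT \<xi>|\<mu>. G\<nu> \<nu> \<xi> x0)" for \<nu>
  have w: "(\<lambda>\<nu>. lam \<nu> powr (- 1 / \<alpha>) *\<^sub>R w \<nu>) \<longlonglongrightarrow> 0"
    using iii(3) by (simp add: w_def)
  \<comment> \<open>Multiplying the null sequence of (iii) by this vanishing factor undoes its
    scaling and gives back \<open>w\<close>, so the perturbations \<open>- w \<nu>\<close> tend to
    0.\<close>
  have lam_powr: "(\<lambda>\<nu>. lam \<nu> powr (1 / \<alpha>)) \<longlonglongrightarrow> 0"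
    using tendsto_powr2[OF iii(2) tendsto_const[of "1 / \<alpha>"]] iii(1) \<open>\<alpha> > 0\<close>
    by (auto simp: less_imp_le)
  have "(\<lambda>\<nu>. lam \<nu> powr (1 / \<alpha>) *\<^sub>R (lam \<nu> powr (- 1 / \<alpha>) *\<^sub>R w \<nu>)) \<longlonglongrightarrow> 0"
    using tendsto_scaleR[OF lam_powr w] by simp
  moreover have "lam \<nu> powr (1 / \<alpha>) *\<^sub>R (lam \<nu> powr (- 1 / \<alpha>) *\<^sub>R w \<nu>) = w \<nu>" for \<nu>
    using iii(1)[of \<nu>] by (simp add: powr_minus_divide)
  ultimately have w0: "(\<lambda>\<nu>. - w \<nu>) \<longlonglongrightarrow> 0"
    using tendsto_minus[of w 0] by simp
  \<comment> \<open>This is \<open>f (0, x0)\<close>, since \<open>iota {0}\<close> vanishes at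
    0.\<close>
  define c where "c = g0 x0 + h (LINT \<xi>|\<mu>. G \<xi> x0)"
  define q where "q \<nu> = 1 / (\<alpha> * lam \<nu>) * norm (- w \<nu>) powr \<alpha>" for \<nu>
  have "q \<nu> = 1 / \<alpha> * norm (lam \<nu> powr (- 1 / \<alpha>) *\<^sub>R w \<nu>) powr \<alpha>" for \<nu>
    unfolding q_def penalty_eq[OF \<open>\<alpha> > 0\<close> iii(1)] by simp
  moreover have "(\<lambda>\<nu>. 1 / \<alpha> * norm (lam \<nu> powr (- 1 / \<alpha>) *\<^sub>R w \<nu>) powr \<alpha>) \<longlonglongrightarrow> 1 / \<alpha> * 0 powr \<alpha>"
    using tendsto_norm_zero[OF w] \<open>\<alpha> > 0\<close>
    by (intro tendsto_mult tendsto_const tendsto_powr2) auto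
  ultimately have q0: "q \<longlonglongrightarrow> 0" by (simp add: q_def[abs_def])
  have le: "f\<nu> \<nu> (- w \<nu>, x0) \<le> c + ereal (q \<nu>)" for \<nu>
  proof -
    have int: "integrable \<mu> (\<lambda>\<xi>. F \<xi> x0)"
      if F: "random_lsc_components \<Xi> F" "\<exists>\<epsilon>>0. \<exists>M. \<forall>\<xi>\<in>\<Xi>. \<forall>y. dist y x0 \<le> \<epsilon> \<longrightarrow> norm (F \<xi> y) \<le> M" for F
    proof -
      obtain \<epsilon> M where "\<epsilon> > 0" "\<And>\<xi> z. \<xi> \<in> \<Xi> \<Longrightarrow> dist z x0 \<le> \<epsilon> \<Longrightarrow> norm (F \<xi> z) \<le> M"
        using F(2) by blast
      then show ?thesis
        by (intro integrable_random_lsc_components[OF \<open>\<mu> \<in> borel_probs \<Xi>\<close> F(1), of _ M]) auto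
    qed
    note intG = int[OF \<open>random_lsc_components \<Xi> G\<close> bd]
      and intG\<nu> = int[OF \<open>random_lsc_components \<Xi> (G\<nu> \<nu>)\<close> bd\<nu>]
    have "(LINT \<xi>|\<mu>. G\<nu> \<nu> \<xi> x0 $ j) \<le> (LINT \<xi>|\<mu>. G \<xi> x0 $ j)" for j
    proof (rule integral_mono_AE)
      show "AE \<xi> in \<mu>. G\<nu> \<nu> \<xi> x0 $ j \<le> G \<xi> x0 $ j"
        using i[of \<nu>] by eventually_elim (simp add: less_eq_vec_def)
    qed (auto intro: integrable_bounded_linear[OF bounded_linear_vec_nth] intG intG\<nu>)
    then have "(LINT \<xi>|\<mu>. G\<nu> \<nu> \<xi> x0) \<le> (LINT \<xi>|\<mu>. G \<xi> x0)"
      using intG intG\<nu> by (simp add: less_eq_vec_def integral_vec_nth)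
    \<comment> \<open>The \<open>\<mu>\<nu> \<nu>\<close>-expectation cancels exactly, so
      \<open>h\<close> is evaluated at a \<open>\<mu>\<close>-expectation that (i) has just
      bounded.\<close>
    moreover have "- w \<nu> + (LINT \<xi>|\<mu>\<nu> \<nu>. G\<nu> \<nu> \<xi> x0) = (LINT \<xi>|\<mu>. G\<nu> \<nu> \<xi> x0)"
      by (simp add: w_def)
    ultimately show ?thesis
      unfolding f\<nu> c_def q_def using monoD[OF \<open>mono h\<close>] by (auto intro!: add_mono)
  qed
  \<comment> \<open>The value \<open>c\<close> may be \<infinity>; addition is still continuous
    because the other limit is finite.\<close>
  have "(\<lambda>\<nu>. c + ereal (q \<nu>)) \<longlonglongrightarrow> c + ereal 0"
    using q0 by (intro tendsto_add_ereal_general1 tendsto_const tendsto_ereal) auto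
  then have "limsup (\<lambda>\<nu>. c + ereal (q \<nu>)) = f (0, x0)"
    by (simp add: lim_imp_Limsup f c_def iota_def)
  moreover have "limsup (\<lambda>\<nu>. f\<nu> \<nu> (- w \<nu>, x0)) \<le> limsup (\<lambda>\<nu>. c + ereal (q \<nu>))"
    using le by (intro Limsup_mono always_eventually allI)
  ultimately have "limsup (\<lambda>\<nu>. f\<nu> \<nu> (- w \<nu>, x0)) \<le> f (0, x0)"
    by simp
  with w0 show "\<exists>U. U \<longlonglongrightarrow> 0 \<and> limsup (\<lambda>\<nu>. f\<nu> \<nu> (U \<nu>, x0)) \<le> f (0, x0)"
    by blast
qed

end
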